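(* Let $R$ be a commutative ring with unity, $Y\subseteq\mathrm{Spec}(R)$, $A$ a multiplicatively closed subset of $R$ and $f:R\to A^{-1}R$ the natural ring homomorphism. If $I$ is an $\mathcal{H}_Y$-ideal of $R$, then $I^{ec}$ is an $\mathcal{H}_Y$-ideal. If $I$ is a strong $\mathcal{H}_Y$-ideal of $R$, then $I^{ec}$ is a strong $\mathcal{H}_Y$-ideal.
   Context: $h_Y(S)=\{P\in Y: S\subseteq P\}$ for $S\subseteq R$, and $h_Y(a)=h_Y(\{a\})$. An ideal $I$ of $R$ (not necessarily proper) is an $\mathcal{H}_Y$-ideal if $a\in I$, $b\in R$ and $h_Y(a)\subseteq h_Y(b)$ imply $b\in I$. It is a strong $\mathcal{H}_Y$-ideal if for every finite subset $F\subseteq I$ and every $b\in R$, $h_Y(F)\subseteq h_Y(b)$ implies $b\in I$. $A^{-1}R$ is the localization of $R$ at $A$. $I^e=\langle f(I)\rangle$ is the extension of $I$ to $A^{-1}R$ and $I^{ec}=f^{-1}(I^e)$. *)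

theory Defs
  imports "HOL-Algebra.QuotRing"
begin

definition Spec :: "('a, 'm) ring_scheme \<Rightarrow> 'a set set"
  where "Spec R = {P. primeideal P R}"

definition hY :: "'a set set \<Rightarrow> 'a set \<Rightarrow> 'a set set"
  where "hY Y S = {P \<in> Y. S \<subseteq> P}"

definition HY_ideal :: "('a, 'm) ring_scheme \<Rightarrow> 'a set set \<Rightarrow> 'a set \<Rightarrow> bool"
  where "HY_ideal R Y I \<longleftrightarrow> ideal I R \<and>
    (\<forall>a \<in> I. \<forall>b \<in> carrier R. hY Y {a} \<subseteq> hY Y {b} \<longrightarrow> b \<in> I)"

definition strong_HY_ideal :: "('a, 'm) ring_scheme \<Rightarrow> 'a set set \<Rightarrow> 'a set \<Rightarrow> bool"
  where "strong_HY_ideal R Y I \<longleftrightarrow> ideal I R \<and>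
    (\<forall>F. finite F \<and> F \<subseteq> I \<longrightarrow>
      (\<forall>b \<in> carrier R. hY Y F \<subseteq> hY Y {b} \<longrightarrow> b \<in> I))"

text \<open>Fractions \<open>a/s\<close> are classes of pairs \<open>(a, s)\<close>. Since \<open>A\<close> may contain
  zero divisors, \<open>a/s = b/t\<close> means \<open>u (a t - b s) = 0\<close> for some \<open>u \<in> A\<close>. No condition
  \<open>0 \<notin> A\<close> is imposed: if \<open>0 \<in> A\<close>, the localization is the zero ring.\<close>

definition frac_rel :: "('a, 'm) ring_scheme \<Rightarrow> 'a set \<Rightarrow> (('a \<times> 'a) \<times> ('a \<times> 'a)) set"
  where "frac_rel R A =
    {((a, s), (b, t)). a \<in> carrier R \<and> b \<in> carrier R \<and> s \<in> A \<and> t \<in> A \<and>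
      (\<exists>u \<in> A. u \<otimes>\<^bsub>R\<^esub> (a \<otimes>\<^bsub>R\<^esub> t \<ominus>\<^bsub>R\<^esub> b \<otimes>\<^bsub>R\<^esub> s) = \<zero>\<^bsub>R\<^esub>)}"

definition fraction :: "('a, 'm) ring_scheme \<Rightarrow> 'a set \<Rightarrow> 'a \<Rightarrow> 'a \<Rightarrow> ('a \<times> 'a) set"
  where "fraction R A a s = frac_rel R A `` {(a, s)}"

text \<open>Operations on classes are unions over all representatives; as these operations do not
  depend on the representatives, each union is a single class.\<close>

definition localization :: "('a, 'm) ring_scheme \<Rightarrow> 'a set \<Rightarrow> ('a \<times> 'a) set ring"
  where "localization R A =
    \<lparr> carrier = (carrier R \<times> A) // frac_rel R A,
      mult = (\<lambda>x y. \<Union>(a, s) \<in> x. \<Union>(b, t) \<in> y. fraction R A (a \<otimes>\<^bsub>R\<^esub> b) (s \<otimes>\<^bsub>R\<^esub> t)),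
      one = fraction R A \<one>\<^bsub>R\<^esub> \<one>\<^bsub>R\<^esub>,
      zero = fraction R A \<zero>\<^bsub>R\<^esub> \<one>\<^bsub>R\<^esub>,
      add = (\<lambda>x y. \<Union>(a, s) \<in> x. \<Union>(b, t) \<in> y.
        fraction R A (a \<otimes>\<^bsub>R\<^esub> t \<oplus>\<^bsub>R\<^esub> b \<otimes>\<^bsub>R\<^esub> s) (s \<otimes>\<^bsub>R\<^esub> t)) \<rparr>"

definition loc_map :: "('a, 'm) ring_scheme \<Rightarrow> 'a set \<Rightarrow> 'a \<Rightarrow> ('a \<times> 'a) set"
  where "loc_map R A r = fraction R A r \<one>\<^bsub>R\<^esub>"

definition loc_ext :: "('a, 'm) ring_scheme \<Rightarrow> 'a set \<Rightarrow> 'a set \<Rightarrow> ('a \<times> 'a) set set"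
  where "loc_ext R A I = Idl\<^bsub>localization R A\<^esub> (loc_map R A ` I)"

definition loc_contr :: "('a, 'm) ring_scheme \<Rightarrow> 'a set \<Rightarrow> ('a \<times> 'a) set set \<Rightarrow> 'a set"
  where "loc_contr R A J = {r \<in> carrier R. loc_map R A r \<in> J}"

end

theory Submission
  imports Defs
begin

text \<open>
  Extending \<open>I\<close> to \<open>A\<^sup>-\<^sup>1R\<close> and contracting it back yields the saturation
  \<open>{r. \<exists>u\<in>A. u r \<in> I}\<close>. If \<open>F\<close> is a finite subset of the saturation, a product \<open>u\<close> of elements
  of \<open>A\<close> satisfies \<open>u F \<subseteq> I\<close>; since the members of \<open>Y\<close> are prime, \<open>h\<^sub>Y(F) \<subseteq> h\<^sub>Y(b)\<close> implies
  \<open>h\<^sub>Y(u F) \<subseteq> h\<^sub>Y(u b)\<close>, whence \<open>u b \<in> I\<close>.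
\<close>

section \<open>Fractions with denominators in a submonoid\<close>

locale cring_submonoid = cring R for R (structure) +
  fixes A
  assumes submonoid: "submonoid A R"
begin

lemma A_one [simp]: "\<one> \<in> A"
  and A_mult [simp]: "\<lbrakk>s \<in> A; t \<in> A\<rbrakk> \<Longrightarrow> s \<otimes> t \<in> A"
  and A_carrier [simp]: "s \<in> A \<Longrightarrow> s \<in> carrier R"
  using submonoid by (auto simp: submonoid_def)

text \<open>Distributing \<open>u\<close> over the difference removes subtraction from the relation,
  so that the computations with representatives below become rearrangements of products and
  sums.\<close>

lemma frac_rel_iff:
  "((a, s), (b, t)) \<in> frac_rel R A \<longleftrightarrow>
    a \<in> carrier R \<and> b \<in> carrier R \<and> s \<in> A \<and> t \<in> A \<and>
    (\<exists>u\<in>A. u \<otimes> (a \<otimes> t) = u \<otimes> (b \<otimes> s))"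
proof -
  have minus: "x \<ominus> y = \<zero> \<longleftrightarrow> x = y" if "x \<in> carrier R" "y \<in> carrier R" for x y
    using that sum_zero_eq_neg[of x "\<ominus> y"] by (auto simp: a_minus_def r_neg)
  have "u \<otimes> (a \<otimes> t \<ominus> b \<otimes> s) = \<zero> \<longleftrightarrow> u \<otimes> (a \<otimes> t) = u \<otimes> (b \<otimes> s)"
    if "a \<in> carrier R" "b \<in> carrier R" "s \<in> A" "t \<in> A" "u \<in> A" for u
  proof -
    have "u \<otimes> (a \<otimes> t \<ominus> b \<otimes> s) = u \<otimes> (a \<otimes> t) \<ominus> u \<otimes> (b \<otimes> s)"
      using that by (simp add: a_minus_def r_distr r_minus)
    with that show ?thesis by (simp add: minus)
  qed
  then show ?thesis unfolding frac_rel_def by auto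
qed

lemma equiv_frac_rel: "equiv (carrier R \<times> A) (frac_rel R A)"
proof (rule equivI)
  show "frac_rel R A \<subseteq> (carrier R \<times> A) \<times> (carrier R \<times> A)"
    by (auto simp: frac_rel_def)
  show "refl_on (carrier R \<times> A) (frac_rel R A)"
    by (auto simp: refl_on_def frac_rel_iff)
  show "sym (frac_rel R A)"
    by (auto simp: sym_def frac_rel_iff intro: sym)
  show "trans (frac_rel R A)"
  proof (rule transI, clarify)
    fix a s b t c r
    assume "((a, s), (b, t)) \<in> frac_rel R A" "((b, t), (c, r)) \<in> frac_rel R A"
    then obtain u v where mem: "a \<in> carrier R" "b \<in> carrier R" "c \<in> carrier R"
        "s \<in> A" "t \<in> A" "r \<in> A" "u \<in> A" "v \<in> A"
      and u: "u \<otimes> (a \<otimes> t) = u \<otimes> (b \<otimes> s)" and v: "v \<otimes> (b \<otimes> r) = v \<otimes> (c \<otimes> t)"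
      unfolding frac_rel_iff by blast
    \<comment> \<open>The middle denominator \<open>t\<close> occurs in both equations and cannot be
      cancelled. It therefore becomes part of the witness: the first equation is multiplied by
      \<open>v \<otimes> r\<close>, the second by \<open>u \<otimes> s\<close>.\<close>
    have "(u \<otimes> v \<otimes> t) \<otimes> (a \<otimes> r) = (u \<otimes> (a \<otimes> t)) \<otimes> (v \<otimes> r)"
      using mem by (simp add: m_ac)
    also have "\<dots> = (v \<otimes> (b \<otimes> r)) \<otimes> (u \<otimes> s)"
      unfolding u using mem by (simp add: m_ac)
    also have "\<dots> = (u \<otimes> v \<otimes> t) \<otimes> (c \<otimes> s)"
      unfolding v using mem by (simp add: m_ac)
    finally show "((a, s), (c, r)) \<in> frac_rel R A"
      unfolding frac_rel_iff using mem A_mult by blast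
  qed
qed

lemma fraction_eq_iff:
  assumes "a \<in> carrier R" "b \<in> carrier R" "s \<in> A" "t \<in> A"
  shows "fraction R A a s = fraction R A b t \<longleftrightarrow> (\<exists>u\<in>A. u \<otimes> (a \<otimes> t) = u \<otimes> (b \<otimes> s))"
  unfolding fraction_def using assms
  by (simp add: eq_equiv_class_iff[OF equiv_frac_rel] frac_rel_iff)

text \<open>If the cross products already agree, any element of \<open>A\<close> is a witness, and
  \<open>A\<close> contains \<open>\<one>\<close>. This case suffices for the identities between
  fractions that make the localization a ring.\<close>

lemma fraction_eqI:
  assumes "a \<in> carrier R" "b \<in> carrier R" "s \<in> A" "t \<in> A" "a \<otimes> t = b \<otimes> s"
  shows "fraction R A a s = fraction R A b t"
  using assms by (auto simp: fraction_eq_iff)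

section \<open>The ring structure of the localization\<close>

lemma fraction_carrier [simp]:
  "\<lbrakk>a \<in> carrier R; s \<in> A\<rbrakk> \<Longrightarrow> fraction R A a s \<in> carrier (localization R A)"
  by (auto simp: localization_def fraction_def intro: quotientI)

lemma localization_carrierE:
  assumes "x \<in> carrier (localization R A)"
  obtains a s where "a \<in> carrier R" "s \<in> A" "x = fraction R A a s"
  using assms by (auto simp: localization_def fraction_def elim!: quotientE)

text \<open>The product is defined as a union over all pairs of representatives. It collapses to one
  class because the class of the product respects the relation in both arguments: if
  \<open>u\<close> and \<open>v\<close> witness the two given equivalences,
  \<open>u \<otimes> v\<close> witnesses that of the products.\<close>

lemma fraction_mult [simp]:
  assumes "a \<in> carrier R" "s \<in> A" "b \<in> carrier R" "t \<in> A"
  shows "fraction R A a s \<otimes>\<^bsub>localization R A\<^esub> fraction R A b t = fraction R A (a \<otimes> b) (s \<otimes> t)"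
proof -
  let ?f = "\<lambda>(a, s) (b, t). fraction R A (a \<otimes> b) (s \<otimes> t)"
  have cong: "congruent2 (frac_rel R A) (frac_rel R A) ?f"
  proof (rule congruent2I', clarsimp)
    fix a s a' s' b t b' t'
    assume "((a, s), (a', s')) \<in> frac_rel R A" "((b, t), (b', t')) \<in> frac_rel R A"
    then obtain u v where mem: "a \<in> carrier R" "a' \<in> carrier R" "b \<in> carrier R" "b' \<in> carrier R"
        "s \<in> A" "s' \<in> A" "t \<in> A" "t' \<in> A" "u \<in> A" "v \<in> A"
      and u: "u \<otimes> (a \<otimes> s') = u \<otimes> (a' \<otimes> s)" and v: "v \<otimes> (b \<otimes> t') = v \<otimes> (b' \<otimes> t)"
      unfolding frac_rel_iff by blast
    have "(u \<otimes> v) \<otimes> ((a \<otimes> b) \<otimes> (s' \<otimes> t')) = (u \<otimes> (a \<otimes> s')) \<otimes> (v \<otimes> (b \<otimes> t'))"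
      using mem by (simp add: m_ac)
    also have "\<dots> = (u \<otimes> v) \<otimes> ((a' \<otimes> b') \<otimes> (s \<otimes> t))"
      unfolding u v using mem by (simp add: m_ac)
    finally show "fraction R A (a \<otimes> b) (s \<otimes> t) = fraction R A (a' \<otimes> b') (s' \<otimes> t')"
      using mem by (subst fraction_eq_iff) (auto intro: A_mult)
  qed
  have "fraction R A a s \<otimes>\<^bsub>localization R A\<^esub> fraction R A b t = ?f (a, s) (b, t)"
    using UN_equiv_class2[OF equiv_frac_rel equiv_frac_rel cong, of "(a, s)" "(b, t)"] assms
    by (simp add: localization_def fraction_def case_prod_unfold)
  then show ?thesis by simp
qed

lemma fraction_add [simp]:
  assumes "a \<in> carrier R" "s \<in> A" "b \<in> carrier R" "t \<in> A"
  shows "fraction R A a s \<oplus>\<^bsub>localization R A\<^esub> fraction R A b t =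
    fraction R A (a \<otimes> t \<oplus> b \<otimes> s) (s \<otimes> t)"
proof -
  let ?f = "\<lambda>(a, s) (b, t). fraction R A (a \<otimes> t \<oplus> b \<otimes> s) (s \<otimes> t)"
  have cong: "congruent2 (frac_rel R A) (frac_rel R A) ?f"
  proof (rule congruent2I', clarsimp)
    fix a s a' s' b t b' t'
    assume "((a, s), (a', s')) \<in> frac_rel R A" "((b, t), (b', t')) \<in> frac_rel R A"
    then obtain u v where mem: "a \<in> carrier R" "a' \<in> carrier R" "b \<in> carrier R" "b' \<in> carrier R"
        "s \<in> A" "s' \<in> A" "t \<in> A" "t' \<in> A" "u \<in> A" "v \<in> A"
      and u: "u \<otimes> (a \<otimes> s') = u \<otimes> (a' \<otimes> s)" and v: "v \<otimes> (b \<otimes> t') = v \<otimes> (b' \<otimes> t)"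
      unfolding frac_rel_iff by blast
    \<comment> \<open>After expansion, each summand contains exactly one of the two cross products
      to be replaced, multiplied by the leftover witness and denominators.\<close>
    have "(u \<otimes> v) \<otimes> ((a \<otimes> t \<oplus> b \<otimes> s) \<otimes> (s' \<otimes> t')) =
        (u \<otimes> (a \<otimes> s')) \<otimes> (v \<otimes> (t \<otimes> t')) \<oplus> (v \<otimes> (b \<otimes> t')) \<otimes> (u \<otimes> (s \<otimes> s'))"
      using mem by (simp add: m_ac l_distr r_distr)
    also have "\<dots> = (u \<otimes> v) \<otimes> ((a' \<otimes> t' \<oplus> b' \<otimes> s') \<otimes> (s \<otimes> t))"
      unfolding u v using mem by (simp add: m_ac l_distr r_distr)
    finally show "fraction R A (a \<otimes> t \<oplus> b \<otimes> s) (s \<otimes> t) =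
        fraction R A (a' \<otimes> t' \<oplus> b' \<otimes> s') (s' \<otimes> t')"
      using mem by (subst fraction_eq_iff) (auto intro: A_mult)
  qed
  have "fraction R A a s \<oplus>\<^bsub>localization R A\<^esub> fraction R A b t = ?f (a, s) (b, t)"
    using UN_equiv_class2[OF equiv_frac_rel equiv_frac_rel cong, of "(a, s)" "(b, t)"] assms
    by (simp add: localization_def fraction_def case_prod_unfold)
  then show ?thesis by simp
qed

lemma localization_one: "\<one>\<^bsub>localization R A\<^esub> = fraction R A \<one> \<one>"
  and localization_zero: "\<zero>\<^bsub>localization R A\<^esub> = fraction R A \<zero> \<one>"
  by (simp_all add: localization_def)

lemma fraction_minus_add:
  assumes "a \<in> carrier R" "s \<in> A"
  shows "fraction R A (\<ominus> a) s \<oplus>\<^bsub>localization R A\<^esub> fraction R A a s = \<zero>\<^bsub>localization R A\<^esub>"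
proof -
  \<comment> \<open>The addition formula puts the sum over \<open>s \<otimes> s\<close>, whereas the
    zero of the localization is written over \<open>\<one>\<close>.\<close>
  have "fraction R A \<zero> (s \<otimes> s) = fraction R A \<zero> \<one>"
    using assms by (intro fraction_eqI) auto
  with assms show ?thesis by (simp add: localization_zero l_minus l_neg)
qed

text \<open>On representatives, the identities hold for numerators and denominators separately,
  except for additive inverses and distributivity, where the two sides agree only as
  classes.\<close>

lemma cring_localization: "cring (localization R A)"
proof (rule cringI)
  show "abelian_group (localization R A)"
  proof (rule abelian_groupI)
    fix x assume "x \<in> carrier (localization R A)"
    then show "\<exists>y\<in>carrier (localization R A).
        y \<oplus>\<^bsub>localization R A\<^esub> x = \<zero>\<^bsub>localization R A\<^esub>"
      by (elim localization_carrierE) (metis fraction_minus_add fraction_carrier a_inv_closed)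
  qed (auto elim!: localization_carrierE simp: localization_zero m_ac a_ac l_distr r_distr)
  show "comm_monoid (localization R A)"
    by (rule comm_monoidI) (auto elim!: localization_carrierE simp: localization_one m_ac)
next
  fix x y z
  assume "x \<in> carrier (localization R A)" "y \<in> carrier (localization R A)"
    "z \<in> carrier (localization R A)"
  then show "(x \<oplus>\<^bsub>localization R A\<^esub> y) \<otimes>\<^bsub>localization R A\<^esub> z =
      x \<otimes>\<^bsub>localization R A\<^esub> z \<oplus>\<^bsub>localization R A\<^esub> y \<otimes>\<^bsub>localization R A\<^esub> z"
    \<comment> \<open>The denominator of \<open>z\<close> enters once on the left and twice on the
      right, so the fractions are compared by their cross products.\<close>
    by (elim localization_carrierE, simp, intro fraction_eqI) (auto simp: m_ac l_distr r_distr)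
qed

section \<open>The saturation of an ideal\<close>

definition saturation :: "'a set \<Rightarrow> 'a set"
  where "saturation I = {r \<in> carrier R. \<exists>u\<in>A. u \<otimes> r \<in> I}"

lemma saturationI: "\<lbrakk>r \<in> carrier R; u \<in> A; u \<otimes> r \<in> I\<rbrakk> \<Longrightarrow> r \<in> saturation I"
  unfolding saturation_def by blast

text \<open>If \<open>u\<close> multiplies \<open>x\<close> into \<open>I\<close> and
  \<open>v\<close> multiplies \<open>y\<close> into \<open>I\<close>, then
  \<open>u \<otimes> v\<close> does so for \<open>x \<oplus> y\<close>. Negatives come from
  absorption, as products with \<open>\<ominus> \<one>\<close>.\<close>

lemma saturation_ideal:
  assumes "ideal I R"
  shows "ideal (saturation I) R"
proof -
  interpret I: ideal I R by fact
  have add: "x \<oplus> y \<in> saturation I" if "x \<in> saturation I" "y \<in> saturation I" for x y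
  proof -
    from that obtain u v where mem: "x \<in> carrier R" "y \<in> carrier R" "u \<in> A" "v \<in> A"
      and uv: "u \<otimes> x \<in> I" "v \<otimes> y \<in> I" unfolding saturation_def by blast
    have "v \<otimes> (u \<otimes> x) \<oplus> u \<otimes> (v \<otimes> y) \<in> I"
      using mem uv by (simp add: I.I_l_closed I.a_closed)
    moreover have "v \<otimes> (u \<otimes> x) \<oplus> u \<otimes> (v \<otimes> y) = (u \<otimes> v) \<otimes> (x \<oplus> y)"
      using mem by (simp add: m_ac r_distr)
    ultimately show ?thesis using mem by (intro saturationI[of _ "u \<otimes> v"]) auto
  qed
  have mult: "x \<otimes> r \<in> saturation I" "r \<otimes> x \<in> saturation I"
    if "x \<in> saturation I" "r \<in> carrier R" for x r
  proof -
    from that obtain u where mem: "x \<in> carrier R" "u \<in> A" and u: "u \<otimes> x \<in> I"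
      unfolding saturation_def by blast
    have "u \<otimes> (x \<otimes> r) \<in> I"
      using I.I_r_closed[OF u that(2)] mem that(2) by (simp add: m_assoc)
    then show "x \<otimes> r \<in> saturation I" using mem that(2) by (auto intro: saturationI)
    then show "r \<otimes> x \<in> saturation I" using mem that(2) by (simp add: m_comm)
  qed
  have zero: "\<zero> \<in> saturation I"
    by (rule saturationI[of _ \<one>]) (auto simp: I.a_subset)
  have neg: "\<ominus> x \<in> saturation I" if "x \<in> saturation I" for x
  proof -
    from that have "x \<in> carrier R" by (simp add: saturation_def)
    then show ?thesis using mult(2)[OF that, of "\<ominus> \<one>"] by (simp add: l_minus)
  qed
  show ?thesis
  proof (rule idealI[OF ring_axioms])
    show "subgroup (saturation I) (add_monoid R)"
    proof (rule add.subgroupI)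
      show "saturation I \<subseteq> carrier R" by (auto simp: saturation_def)
      show "saturation I \<noteq> {}" using zero by blast
    qed (simp_all add: add neg flip: a_inv_def)
  qed (auto intro: mult)
qed

section \<open>Contraction of the extension\<close>

lemma fraction_ideal:
  assumes "ideal I R"
  defines "J \<equiv> {fraction R A i s | i s. i \<in> I \<and> s \<in> A}"
  shows "ideal J (localization R A)"
proof -
  interpret I: ideal I R by fact
  interpret L: cring "localization R A" by (rule cring_localization)
  have I [simp]: "i \<in> carrier R" if "i \<in> I" for i using that by (rule I.Icarr)
  have JI: "fraction R A i s \<in> J" if "i \<in> I" "s \<in> A" for i s
    using that unfolding J_def by blast
  have sub: "J \<subseteq> carrier (localization R A)"
    unfolding J_def by auto
  have mult: "x \<otimes>\<^bsub>localization R A\<^esub> y \<in> J"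
    if x: "x \<in> carrier (localization R A)" and y: "y \<in> J" for x y
  proof -
    from x obtain a s where "a \<in> carrier R" "s \<in> A" "x = fraction R A a s"
      by (rule localization_carrierE)
    moreover from y obtain i t where "i \<in> I" "t \<in> A" "y = fraction R A i t"
      unfolding J_def by blast
    \<comment> \<open>The product has numerator \<open>a \<otimes> i\<close>, which \<open>I\<close>
      absorbs, and denominator \<open>s \<otimes> t\<close> in \<open>A\<close>.\<close>
    ultimately show ?thesis by (simp add: JI I.I_l_closed)
  qed
  show ?thesis
  proof (rule idealI[OF L.ring_axioms])
    show "subgroup J (add_monoid (localization R A))"
    proof (rule L.add.subgroupI)
      show "J \<subseteq> carrier (localization R A)" by (rule sub)
      show "J \<noteq> {}" using JI[of \<zero> \<one>] by auto
    next
      fix x assume x: "x \<in> J"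
      then have "x \<in> carrier (localization R A)" using sub by blast
      then show "\<ominus>\<^bsub>localization R A\<^esub> x \<in> J"
        using mult[of "\<ominus>\<^bsub>localization R A\<^esub> \<one>\<^bsub>localization R A\<^esub>" x] x by (simp add: L.l_minus)
    next
      fix x y assume "x \<in> J" "y \<in> J"
      then obtain i s j t where "i \<in> I" "s \<in> A" "j \<in> I" "t \<in> A"
        "x = fraction R A i s" "y = fraction R A j t" unfolding J_def by blast
      then show "x \<oplus>\<^bsub>localization R A\<^esub> y \<in> J"
        by (simp add: JI I.I_r_closed I.a_closed)
    qed
  next
    fix x y assume "x \<in> J" "y \<in> carrier (localization R A)"
    then show "y \<otimes>\<^bsub>localization R A\<^esub> x \<in> J" "x \<otimes>\<^bsub>localization R A\<^esub> y \<in> J"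
      using mult[of y x] sub by (auto simp: L.m_comm)
  qed
qed

lemma contr_ext_eq_saturation:
  assumes "ideal I R"
  shows "loc_contr R A (loc_ext R A I) = saturation I"
proof (intro subset_antisym subsetI)
  interpret I: ideal I R by fact
  fix r assume "r \<in> loc_contr R A (loc_ext R A I)"
  then have r: "r \<in> carrier R" and ext: "fraction R A r \<one> \<in> loc_ext R A I"
    by (auto simp: loc_contr_def loc_map_def)
  have "loc_map R A ` I \<subseteq> {fraction R A i s | i s. i \<in> I \<and> s \<in> A}"
    unfolding loc_map_def using A_one by blast
  \<comment> \<open>The extension is the intersection of all ideals containing the image of
    \<open>I\<close>, and the set of fractions with numerator in \<open>I\<close> is one of
    them.\<close>
  then have "loc_ext R A I \<subseteq> {fraction R A i s | i s. i \<in> I \<and> s \<in> A}"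
    unfolding loc_ext_def genideal_def using fraction_ideal[OF assms] by blast
  with ext obtain i s where i: "i \<in> I" "s \<in> A" "fraction R A r \<one> = fraction R A i s" by auto
  then obtain u where u: "u \<in> A" "u \<otimes> (r \<otimes> s) = u \<otimes> (i \<otimes> \<one>)"
    using r I.Icarr by (auto simp: fraction_eq_iff)
  \<comment> \<open>By the previous equation this element is a multiple of \<open>i\<close>.
    Regrouping then makes \<open>u \<otimes> s\<close>, an element of \<open>A\<close>, the
    multiplier that takes \<open>r\<close> into \<open>I\<close>.\<close>
  have "u \<otimes> (r \<otimes> s) \<in> I" using u i by (simp add: I.Icarr I.I_l_closed)
  then have "(u \<otimes> s) \<otimes> r \<in> I" using u i r by (simp add: m_ac)
  then show "r \<in> saturation I" using u i r by (auto intro: saturationI[of _ "u \<otimes> s"])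
next
  interpret I: ideal I R by fact
  fix r assume "r \<in> saturation I"
  then obtain u where r: "r \<in> carrier R" and u: "u \<in> A" "u \<otimes> r \<in> I"
    unfolding saturation_def by blast
  \<comment> \<open>Membership in the extension is tested on every ideal \<open>J\<close> containing
    the image of \<open>I\<close>. In the localization \<open>u\<close> becomes invertible, and
    multiplying the image of \<open>u \<otimes> r\<close> by \<open>1/u\<close> recovers that of
    \<open>r\<close>.\<close>
  have "fraction R A r \<one> \<in> J" if J: "ideal J (localization R A)" "loc_map R A ` I \<subseteq> J" for J
  proof -
    have "fraction R A (u \<otimes> r) \<one> \<in> J" using u J by (auto simp: loc_map_def)
    then have "fraction R A \<one> u \<otimes>\<^bsub>localization R A\<^esub> fraction R A (u \<otimes> r) \<one> \<in> J"
      using u by (intro ideal.I_l_closed[OF J(1)]) auto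
    moreover have "fraction R A \<one> u \<otimes>\<^bsub>localization R A\<^esub> fraction R A (u \<otimes> r) \<one>
        = fraction R A r \<one>"
      using u r by (simp, intro fraction_eqI) (auto simp: m_ac)
    ultimately show ?thesis by simp
  qed
  then show "r \<in> loc_contr R A (loc_ext R A I)"
    using r by (auto simp: loc_contr_def loc_ext_def genideal_def loc_map_def)
qed

section \<open>Saturations of \<open>HY_ideal\<close> and \<open>strong_HY_ideal\<close>\<close>

lemma finite_subset_saturation:
  assumes "ideal I R" "finite F" "F \<subseteq> saturation I"
  obtains u where "u \<in> A" "(\<otimes>) u ` F \<subseteq> I"
proof -
  interpret I: ideal I R by fact
  from assms(2,3) have "\<exists>u\<in>A. (\<otimes>) u ` F \<subseteq> I"
  proof (induction F)
    case empty
    then show ?case using A_one by blast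
  next
    case (insert x F)
    then obtain u v where u: "u \<in> A" "(\<otimes>) u ` F \<subseteq> I" and v: "v \<in> A" "v \<otimes> x \<in> I"
      and x: "x \<in> carrier R" unfolding saturation_def by auto
    \<comment> \<open>The multiplier \<open>v\<close> of the new element is multiplied onto the
      common multiplier \<open>u\<close> of the others; for each \<open>y\<close> one factor takes
      it into \<open>I\<close> and the ideal absorbs the other.\<close>
    have "(u \<otimes> v) \<otimes> y \<in> I" if "y \<in> insert x F" for y
    proof (cases "y = x")
      case True
      then show ?thesis using u v x by (simp add: m_assoc I.I_l_closed)
    next
      case False
      with that insert.prems u have y: "y \<in> carrier R" "u \<otimes> y \<in> I"
        by (auto simp: saturation_def)
      have "(u \<otimes> v) \<otimes> y = v \<otimes> (u \<otimes> y)" using y u v by (simp add: m_ac)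
      then show ?thesis using y v by (simp add: I.I_l_closed)
    qed
    then show ?case using u v by (intro bexI[of _ "u \<otimes> v"]) auto
  qed
  then show ?thesis using that by blast
qed

lemma hY_mult_mono:
  assumes "Y \<subseteq> Spec R" "F \<subseteq> carrier R" "b \<in> carrier R" "u \<in> carrier R"
    and "hY Y F \<subseteq> hY Y {b}"
  shows "hY Y ((\<otimes>) u ` F) \<subseteq> hY Y {u \<otimes> b}"
proof
  fix P assume "P \<in> hY Y ((\<otimes>) u ` F)"
  then have P: "P \<in> Y" "(\<otimes>) u ` F \<subseteq> P" by (auto simp: hY_def)
  with assms(1) interpret P: primeideal P R by (auto simp: Spec_def)
  have "u \<otimes> b \<in> P"
  \<comment> \<open>A prime containing \<open>u\<close> contains \<open>u \<otimes> b\<close>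
    outright. In any other prime, \<open>u\<close> can be cancelled from each product, which leaves
    \<open>F \<subseteq> P\<close>, so that the inclusion of hulls applies.\<close>
  proof (cases "u \<in> P")
    case True
    then show ?thesis using assms(3) by (rule P.I_r_closed)
  next
    case False
    then have "F \<subseteq> P" using P(2) P.I_prime[OF assms(4)] assms(2) by blast
    then have "b \<in> P" using P(1) assms(5) by (auto simp: hY_def)
    then show ?thesis using assms(4) by (rule P.I_l_closed)
  qed
  then show "P \<in> hY Y {u \<otimes> b}" using P(1) by (simp add: hY_def)
qed

text \<open>The multiplier \<open>u\<close> that witnesses \<open>a\<close> in the saturation also
  serves for \<open>b\<close>: the hull inclusion passes from \<open>a\<close>, \<open>b\<close> to
  their multiples by \<open>u\<close>, where the property of \<open>I\<close> applies.\<close>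

lemma HY_ideal_saturation:
  assumes "Y \<subseteq> Spec R" "HY_ideal R Y I"
  shows "HY_ideal R Y (saturation I)"
  unfolding HY_ideal_def
proof (intro conjI ballI impI)
  show "ideal (saturation I) R" using assms(2) by (simp add: HY_ideal_def saturation_ideal)
next
  fix a b assume a: "a \<in> saturation I" and b: "b \<in> carrier R" "hY Y {a} \<subseteq> hY Y {b}"
  from a obtain u where u: "a \<in> carrier R" "u \<in> A" "u \<otimes> a \<in> I"
    unfolding saturation_def by blast
  then have "hY Y {u \<otimes> a} \<subseteq> hY Y {u \<otimes> b}"
    using hY_mult_mono[OF assms(1), of "{a}" b u] b by simp
  then have "u \<otimes> b \<in> I" using assms(2) u b by (auto simp: HY_ideal_def)
  then show "b \<in> saturation I" using b u by (auto intro: saturationI)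
qed

text \<open>The argument for a single element carries over once one multiplier serves all of
  \<open>F\<close>. The multiplied set is again finite, as the property of \<open>I\<close>
  demands.\<close>

lemma strong_HY_ideal_saturation:
  assumes "Y \<subseteq> Spec R" "strong_HY_ideal R Y I"
  shows "strong_HY_ideal R Y (saturation I)"
  unfolding strong_HY_ideal_def
proof (intro conjI allI ballI impI)
  show "ideal (saturation I) R"
    using assms(2) by (simp add: strong_HY_ideal_def saturation_ideal)
next
  fix F b assume F: "finite F \<and> F \<subseteq> saturation I"
    and b: "b \<in> carrier R" "hY Y F \<subseteq> hY Y {b}"
  from F assms(2) obtain u where u: "u \<in> A" "(\<otimes>) u ` F \<subseteq> I"
    by (auto simp: strong_HY_ideal_def elim: finite_subset_saturation)
  have "F \<subseteq> carrier R" using F by (auto simp: saturation_def)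
  then have "hY Y ((\<otimes>) u ` F) \<subseteq> hY Y {u \<otimes> b}"
    using hY_mult_mono[OF assms(1)] b u by simp
  moreover have "finite ((\<otimes>) u ` F)" "u \<otimes> b \<in> carrier R" using F b u by simp_all
  ultimately have "u \<otimes> b \<in> I"
    using assms(2) u(2) unfolding strong_HY_ideal_def by blast
  then show "b \<in> saturation I" using b u by (auto intro: saturationI)
qed

end

theorem proposition6p6:
  fixes R :: "('a, 'm) ring_scheme" and Y :: "'a set set" and A I :: "'a set"
  assumes "cring R" and "Y \<subseteq> Spec R" and "submonoid A R"
  shows "(HY_ideal R Y I \<longrightarrow> HY_ideal R Y (loc_contr R A (loc_ext R A I))) \<and>
    (strong_HY_ideal R Y I \<longrightarrow> strong_HY_ideal R Y (loc_contr R A (loc_ext R A I)))"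
proof -
  \<comment> \<open>A multiplicatively closed set is encoded as a submonoid: it contains
    \<open>\<one>\<close> and may contain \<open>\<zero>\<close>.\<close>
  interpret cring_submonoid R A
    using assms(1,3) by (simp add: cring_submonoid_def cring_submonoid_axioms_def)
  \<comment> \<open>Either property includes that \<open>I\<close> is an ideal, which is what the
    description of the contracted extension as a saturation requires.\<close>
  have "loc_contr R A (loc_ext R A I) = saturation I" if "HY_ideal R Y I \<or> strong_HY_ideal R Y I"
    using that contr_ext_eq_saturation by (auto simp only: HY_ideal_def strong_HY_ideal_def)
  then show ?thesis
    using HY_ideal_saturation[OF assms(2)] strong_HY_ideal_saturation[OF assms(2)] by simp
qed

end
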